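(* Let $n\ge 3$ be odd. The subgroup $\mathbf{O}_E$ of the $n\times n\times n$ Rubik's Cube group $\mathbf{G}$ consisting of the elements that leave every cubie in its position and fix every sticker not lying on a single edge cubie (so that they only change single edge orientations) is isomorphic to $\mathbb{Z}_2^{11}$.
   Context: The $n\times n\times n$ Rubik's Cube has faces U, D, F, B, R, L, each an $n\times n$ grid of facelets carrying stickers ($6n^2$ in total). For $1\le k\le\lfloor n/2\rfloor$, $F_k,B_k,R_k,L_k,U_k,D_k$ denote clockwise (seen from the named face) $90^\circ$ rotations of the $k$-th $n\times n\times 1$ slice counted from the named face. $\mathbf{G}$ is the subgroup of the symmetric group on the facelets generated by the facelet permutations induced by these moves. Along each of the 12 edges of the big cube lie edge cubies (two stickers) at positions $2,\dots,n-1$; for odd $n$ the one at position $(n+1)/2$ is a single edge (12 in total), which can be flipped in place between 2 orientations (elements of $\mathbb{Z}_2$). *)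

theory Defs
  imports "HOL-Algebra.Algebra"
begin

datatype face = FaceU | FaceD | FaceF | FaceB | FaceR | FaceL

text \<open>
  Cubie positions are triples of coordinates in \<open>{1..n}\<close>, with the x-axis pointing right, the
  y-axis up and the z-axis to the front. A facelet is a face together with a cubie position
  lying on that face.
\<close>

type_synonym position = "nat \<times> nat \<times> nat"

type_synonym facelet = "face \<times> position"

fun in_slice :: "nat \<Rightarrow> face \<Rightarrow> nat \<Rightarrow> position \<Rightarrow> bool" where
  "in_slice n FaceU k (x, y, z) \<longleftrightarrow> y = n + 1 - k"
| "in_slice n FaceD k (x, y, z) \<longleftrightarrow> y = k"
| "in_slice n FaceF k (x, y, z) \<longleftrightarrow> z = n + 1 - k"
| "in_slice n FaceB k (x, y, z) \<longleftrightarrow> z = k"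
| "in_slice n FaceR k (x, y, z) \<longleftrightarrow> x = n + 1 - k"
| "in_slice n FaceL k (x, y, z) \<longleftrightarrow> x = k"

definition positions :: "nat \<Rightarrow> position set" where
  "positions n = {1..n} \<times> {1..n} \<times> {1..n}"

definition facelets :: "nat \<Rightarrow> facelet set" where
  "facelets n = {(f, p). p \<in> positions n \<and> in_slice n f 1 p}"

text \<open>
  Clockwise quarter turns, as seen when looking at the named face from outside the cube:
  \<open>rot_pos\<close> is the effect on positions, \<open>rot_face\<close> the effect on the direction a sticker faces.
\<close>

fun rot_pos :: "nat \<Rightarrow> face \<Rightarrow> position \<Rightarrow> position" where
  "rot_pos n FaceU (x, y, z) = (n + 1 - z, y, x)"
| "rot_pos n FaceD (x, y, z) = (z, y, n + 1 - x)"
| "rot_pos n FaceF (x, y, z) = (y, n + 1 - x, z)"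
| "rot_pos n FaceB (x, y, z) = (n + 1 - y, x, z)"
| "rot_pos n FaceR (x, y, z) = (x, z, n + 1 - y)"
| "rot_pos n FaceL (x, y, z) = (x, n + 1 - z, y)"

fun rot_face :: "face \<Rightarrow> face \<Rightarrow> face" where
  "rot_face FaceU f = (case f of FaceF \<Rightarrow> FaceL | FaceL \<Rightarrow> FaceB | FaceB \<Rightarrow> FaceR | FaceR \<Rightarrow> FaceF | _ \<Rightarrow> f)"
| "rot_face FaceD f = (case f of FaceF \<Rightarrow> FaceR | FaceR \<Rightarrow> FaceB | FaceB \<Rightarrow> FaceL | FaceL \<Rightarrow> FaceF | _ \<Rightarrow> f)"
| "rot_face FaceF f = (case f of FaceU \<Rightarrow> FaceR | FaceR \<Rightarrow> FaceD | FaceD \<Rightarrow> FaceL | FaceL \<Rightarrow> FaceU | _ \<Rightarrow> f)"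
| "rot_face FaceB f = (case f of FaceU \<Rightarrow> FaceL | FaceL \<Rightarrow> FaceD | FaceD \<Rightarrow> FaceR | FaceR \<Rightarrow> FaceU | _ \<Rightarrow> f)"
| "rot_face FaceR f = (case f of FaceF \<Rightarrow> FaceU | FaceU \<Rightarrow> FaceB | FaceB \<Rightarrow> FaceD | FaceD \<Rightarrow> FaceF | _ \<Rightarrow> f)"
| "rot_face FaceL f = (case f of FaceF \<Rightarrow> FaceD | FaceD \<Rightarrow> FaceB | FaceB \<Rightarrow> FaceU | FaceU \<Rightarrow> FaceF | _ \<Rightarrow> f)"

text \<open>A permutation sends a facelet to the facelet to which it carries the sticker there.\<close>

definition move :: "nat \<Rightarrow> face \<Rightarrow> nat \<Rightarrow> facelet \<Rightarrow> facelet" where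
  "move n f k = (\<lambda>(g, p) \<in> facelets n.
     if in_slice n f k p then (rot_face f g, rot_pos n f p) else (g, p))"

definition moves :: "nat \<Rightarrow> (facelet \<Rightarrow> facelet) set" where
  "moves n = {move n f k | f k. 1 \<le> k \<and> k \<le> n div 2}"

definition cube_group :: "nat \<Rightarrow> (facelet \<Rightarrow> facelet) monoid" where
  "cube_group n = (BijGroup (facelets n))
     \<lparr>carrier := generate (BijGroup (facelets n)) (moves n)\<rparr>"

text \<open>
  For odd \<open>n\<close>: two coordinates are extremal, so the cubie lies on an edge of the big cube, and
  the coordinate along this edge is the middle one.
\<close>

definition single_edges :: "nat \<Rightarrow> position set" where
  "single_edges n = (let m = (n + 1) div 2; e = {1, n} in
     ({m} \<times> e \<times> e) \<union> (e \<times> {m} \<times> e) \<union> (e \<times> e \<times> {m}))"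

definition single_edge_orientations :: "nat \<Rightarrow> (facelet \<Rightarrow> facelet) set" where
  "single_edge_orientations n = {\<sigma> \<in> carrier (cube_group n).
     (\<forall>s \<in> facelets n. snd (\<sigma> s) = snd s) \<and>
     (\<forall>s \<in> facelets n. snd s \<notin> single_edges n \<longrightarrow> \<sigma> s = s)}"

lemma facelets_iff:
  "(f, x, y, z) \<in> facelets n \<longleftrightarrow>
     x \<in> {1..n} \<and> y \<in> {1..n} \<and> z \<in> {1..n} \<and>
     (case f of FaceU \<Rightarrow> y = n | FaceD \<Rightarrow> y = 1 | FaceF \<Rightarrow> z = n
              | FaceB \<Rightarrow> z = 1 | FaceR \<Rightarrow> x = n | FaceL \<Rightarrow> x = 1)"
  by (cases f) (auto simp: facelets_def positions_def)

lemma finite_facelets: "finite (facelets n)"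
proof (rule finite_subset)
  have "(UNIV :: face set) = {FaceU, FaceD, FaceF, FaceB, FaceR, FaceL}"
    using face.exhaust by blast
  then have "finite (UNIV :: face set)"
    by (metis finite.emptyI finite.insertI)
  then show "finite ((UNIV :: face set) \<times> positions n)"
    by (simp add: positions_def)
  show "facelets n \<subseteq> (UNIV :: face set) \<times> positions n"
    by (auto simp: facelets_def)
qed

lemma move_in_Bij: "move n f k \<in> Bij (facelets n)"
proof -
  let ?S = "facelets n"
  have ext: "move n f k \<in> extensional ?S"
    by (simp add: move_def)
  have into: "move n f k \<in> ?S \<rightarrow> ?S"
  proof
    fix s assume s: "s \<in> ?S"
    obtain g x y z where sz: "s = (g, x, y, z)" by (metis prod.exhaust)
    show "move n f k s \<in> ?S"
      using s unfolding sz move_def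
      by (cases f; cases g; auto simp: facelets_iff)
  qed
  have slice: "in_slice n f k (rot_pos n f p) = in_slice n f k p" for p
    by (cases p; cases f) auto
  have face: "rot_face f g = rot_face f h \<Longrightarrow> g = h" for g h
    by (cases f; cases g; cases h) simp_all
  have pos: "p = q" if "p \<in> positions n" "q \<in> positions n" "rot_pos n f p = rot_pos n f q" for p q
    using that by (cases p; cases q; cases f) (auto simp: positions_def)
  have inj: "inj_on (move n f k) ?S"
  proof (rule inj_onI)
    fix s t assume st: "s \<in> ?S" "t \<in> ?S" "move n f k s = move n f k t"
    obtain g p where s: "s = (g, p)" by (cases s)
    obtain h q where t: "t = (h, q)" by (cases t)
    have pq: "p \<in> positions n" "q \<in> positions n"
      using st(1,2) by (simp_all add: s t facelets_def)
    have eq: "(if in_slice n f k p then (rot_face f g, rot_pos n f p) else (g, p)) =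
        (if in_slice n f k q then (rot_face f h, rot_pos n f q) else (h, q))"
      using st unfolding move_def s t by simp
    have "in_slice n f k p = in_slice n f k q"
      using arg_cong[OF eq, of "\<lambda>s. in_slice n f k (snd s)"] slice by (auto split: if_splits)
    with eq pos[OF pq] face show "s = t"
      by (auto simp: s t split: if_splits)
  qed
  have "move n f k ` ?S = ?S"
    using endo_inj_surj[OF finite_facelets _ inj] into by blast
  with ext inj show ?thesis
    by (simp add: Bij_def bij_betw_def)
qed

end

theory Submission
  imports Defs "HOL-Combinatorics.Permutations"
begin

text \<open>
  Write \<open>flip P\<close> for the permutation exchanging the two stickers of every single edge in \<open>P\<close>; the
  elements in question are exactly the \<open>flip P\<close> lying in the cube group.

  Every generator acts as an even permutation on the 24 single edge facelets: an inner slice fixes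
  them all, and a face turn consists of two 4-cycles. As \<open>flip {p}\<close> is a transposition there, it is
  not in the cube group.

  Conversely, let \<open>N\<close> turn all horizontal slices except the middle one, and let
  \<open>A = R N\<^sup>2 L\<^sup>2 N F\<close>. Up to a rotation of the whole cube about the vertical axis, this is five moves of which
  two turn only the middle slice; on the top layer it is a rotation followed by the flip of a single
  edge. Hence the commutator of \<open>A\<close> with \<open>U\<close> flips two adjacent edges and fixes everything else.
  Conjugating by face turns, all pairs of single edges can be flipped. So for each set of the eleven
  edges other than UR, exactly one of the two choices at UR gives an element of the cube group.
\<close>

section \<open>Total versions of moves, flips and layer rotations\<close>

definition rot :: "nat \<Rightarrow> face \<Rightarrow> facelet \<Rightarrow> facelet" where
  "rot n f s = (rot_face f (fst s), rot_pos n f (snd s))"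

definition turn :: "nat \<Rightarrow> face \<Rightarrow> nat \<Rightarrow> facelet \<Rightarrow> facelet" where
  "turn n f k s = (if in_slice n f k (snd s) then rot n f s else s)"

definition turn_pos :: "nat \<Rightarrow> face \<Rightarrow> position \<Rightarrow> position" where
  "turn_pos n f p = (if in_slice n f 1 p then rot_pos n f p else p)"

text \<open>Group elements must be undefined outside \<open>facelets n\<close>. Restricting only
  here lets the rest of the proof use total functions and plain composition.\<close>

definition reachable :: "nat \<Rightarrow> (facelet \<Rightarrow> facelet) \<Rightarrow> bool" where
  "reachable n h \<longleftrightarrow> restrict h (facelets n) \<in> carrier (cube_group n)"

text \<open>Intended for \<open>edge_facelets n\<close>, where the cubie shows exactly one further
  face (\<open>ex1_opp\<close>). The position is kept for every argument, so \<open>snd_flip\<close>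
  needs no side condition.\<close>

definition opp :: "nat \<Rightarrow> facelet \<Rightarrow> facelet" where
  "opp n s = (THE g. g \<noteq> fst s \<and> (g, snd s) \<in> facelets n, snd s)"

definition edge_facelets :: "nat \<Rightarrow> facelet set" where
  "edge_facelets n = {s \<in> facelets n. snd s \<in> single_edges n}"

definition flip :: "nat \<Rightarrow> position set \<Rightarrow> facelet \<Rightarrow> facelet" where
  "flip n P s = (if snd s \<in> P then opp n s else s)"

text \<open>The parameter \<open>j\<close> serves an induction that adds one pair of layers at a
  time; the case \<open>j = m - 1\<close> agrees with \<open>outer_rot\<close> on the
  facelets.\<close>

definition slab :: "nat \<Rightarrow> nat \<Rightarrow> facelet \<Rightarrow> facelet" where
  "slab n j s = (let y = fst (snd (snd s)) in if y \<le> j \<or> n + 1 - j \<le> y then rot n FaceU s else s)"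

lemma face_all_iff:
  "(\<forall>f. P f) \<longleftrightarrow> P FaceU \<and> P FaceD \<and> P FaceF \<and> P FaceB \<and> P FaceR \<and> P FaceL"
  by (metis face.exhaust)

lemma face_ex_iff:
  "(\<exists>f. P f) \<longleftrightarrow> P FaceU \<or> P FaceD \<or> P FaceF \<or> P FaceB \<or> P FaceR \<or> P FaceL"
  by (metis face.exhaust)

section \<open>The cube group and closure properties of reachability\<close>

lemma carrier_cube_group:
  "carrier (cube_group n) = generate (BijGroup (facelets n)) (moves n)"
  by (simp add: cube_group_def)

lemma moves_subset_Bij: "moves n \<subseteq> carrier (BijGroup (facelets n))"
  by (auto simp: moves_def BijGroup_def move_in_Bij)

lemma subgroup_cube_group: "subgroup (carrier (cube_group n)) (BijGroup (facelets n))"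
  unfolding carrier_cube_group
  by (rule group.generate_is_subgroup[OF group_BijGroup moves_subset_Bij])

lemma group_cube_group: "group (cube_group n)"
  using subgroup.subgroup_is_group[OF subgroup_cube_group group_BijGroup]
  by (simp add: cube_group_def)

lemma cube_group_Bij: "g \<in> carrier (cube_group n) \<Longrightarrow> g \<in> Bij (facelets n)"
  using subgroup.subset[OF subgroup_cube_group] by (auto simp: BijGroup_def)

lemma mult_cube_group:
  assumes "f \<in> carrier (cube_group n)" "g \<in> carrier (cube_group n)"
  shows "f \<otimes>\<^bsub>cube_group n\<^esub> g = compose (facelets n) f g"
  using assms[THEN cube_group_Bij] by (simp add: cube_group_def BijGroup_def)

lemma one_cube_group: "\<one>\<^bsub>cube_group n\<^esub> = (\<lambda>s\<in>facelets n. s)"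
  by (simp add: cube_group_def BijGroup_def)

lemma reachable_maps: "reachable n h \<Longrightarrow> s \<in> facelets n \<Longrightarrow> h s \<in> facelets n"
  unfolding reachable_def by (drule cube_group_Bij, drule Bij_imp_funcset) (metis PiE restrict_apply')

lemma reachable_inj: "reachable n h \<Longrightarrow> inj_on h (facelets n)"
  unfolding reachable_def by (drule cube_group_Bij) (auto simp: Bij_def bij_betw_def inj_on_def)

lemma reachable_cong:
  "(\<And>s. s \<in> facelets n \<Longrightarrow> f s = g s) \<Longrightarrow> reachable n f \<longleftrightarrow> reachable n g"
  unfolding reachable_def by (metis restrict_ext)

lemma restrict_comp:
  "(\<And>s. s \<in> A \<Longrightarrow> g s \<in> A) \<Longrightarrow> restrict (f \<circ> g) A = compose A (restrict f A) (restrict g A)"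
  by (auto simp: compose_def restrict_def fun_eq_iff)

lemma reachable_comp:
  assumes "reachable n f" "reachable n g"
  shows "reachable n (f \<circ> g)"
proof -
  have "compose (facelets n) (restrict f (facelets n)) (restrict g (facelets n)) \<in> carrier (cube_group n)"
    using assms unfolding reachable_def
    by (metis mult_cube_group group.is_monoid group_cube_group monoid.m_closed)
  then show ?thesis
    using reachable_maps[OF assms(2)] by (simp add: reachable_def restrict_comp)
qed

lemma reachable_id: "reachable n (\<lambda>s. s)"
  unfolding reachable_def one_cube_group[symmetric]
  by (rule monoid.one_closed[OF group.is_monoid[OF group_cube_group]])

text \<open>In \<open>BijGroup\<close> one has \<open>f = (f g) g^-1\<close>. This turns conjugation
  and commutator formulas into equations without inverses: to reach \<open>f\<close> it suffices to
  know \<open>f \<circ> g\<close> as a product of moves.\<close>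

lemma reachable_cancel:
  assumes "bij_betw f (facelets n) (facelets n)" "reachable n g" "reachable n (f \<circ> g)"
  shows "reachable n f"
proof -
  let ?B = "BijGroup (facelets n)" and ?f = "restrict f (facelets n)" and ?g = "restrict g (facelets n)"
  interpret B: group ?B by (rule group_BijGroup)
  have f: "?f \<in> carrier ?B"
    using assms(1) by (simp add: BijGroup_def Bij_def)
  have g: "?g \<in> carrier (cube_group n)"
    using assms(2) by (simp add: reachable_def)
  have gB: "?g \<in> carrier ?B"
    using subgroup.subset[OF subgroup_cube_group] g by auto
  have "?f \<otimes>\<^bsub>?B\<^esub> ?g = compose (facelets n) ?f ?g"
    using f gB by (simp add: BijGroup_def)
  also have "\<dots> = restrict (f \<circ> g) (facelets n)"
    using reachable_maps[OF assms(2)] by (simp add: restrict_comp)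
  finally have fg: "?f \<otimes>\<^bsub>?B\<^esub> ?g \<in> carrier (cube_group n)"
    using assms(3) by (simp add: reachable_def)
  have "?f = (?f \<otimes>\<^bsub>?B\<^esub> ?g) \<otimes>\<^bsub>?B\<^esub> inv\<^bsub>?B\<^esub> ?g"
    using f gB by (simp add: B.m_assoc)
  then show ?thesis
    unfolding reachable_def
    using fg g subgroup.m_closed[OF subgroup_cube_group] subgroup.m_inv_closed[OF subgroup_cube_group]
    by metis
qed

section \<open>Turns of slices and their action on positions\<close>

lemma restrict_turn: "restrict (turn n f k) (facelets n) = move n f k"
  by (auto simp: turn_def rot_def move_def restrict_def fun_eq_iff)

lemma reachable_turn: "1 \<le> k \<Longrightarrow> k \<le> n div 2 \<Longrightarrow> reachable n (turn n f k)"
  unfolding reachable_def restrict_turn carrier_cube_group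
  by (rule generate.incl) (auto simp: moves_def)

lemma turn_facelets: "s \<in> facelets n \<Longrightarrow> turn n f k s \<in> facelets n"
  using move_in_Bij[of n f k, THEN Bij_imp_funcset] unfolding restrict_turn[symmetric]
  by (metis PiE restrict_apply')

lemma snd_turn: "snd (turn n f 1 s) = turn_pos n f (snd s)"
  by (simp add: turn_def turn_pos_def rot_def)

lemma rot_face_inject: "rot_face f g = rot_face f h \<longleftrightarrow> g = h"
  by (cases f; cases g; cases h) simp_all

lemma rot_face_self_iff: "rot_face f g = f \<longleftrightarrow> g = f"
  by (cases f; cases g) simp_all

lemma in_slice_rot_pos: "in_slice n f k (rot_pos n f p) = in_slice n f k p"
  by (cases p; cases f) auto

text \<open>A turn preserves its slice, so positions with equal images are both inside or both
  outside it. The domain matters: on larger coordinates the natural number subtraction in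
  \<open>rot_pos\<close> truncates.\<close>

lemma inj_on_turn_pos: "inj_on (turn_pos n f) (positions n)"
proof (rule inj_onI)
  fix p q assume pq: "p \<in> positions n" "q \<in> positions n" "turn_pos n f p = turn_pos n f q"
  have "in_slice n f 1 p = in_slice n f 1 q"
    using arg_cong[OF pq(3), of "in_slice n f 1"]
    by (auto simp: turn_pos_def in_slice_rot_pos split: if_splits)
  then show "p = q"
    using pq by (cases p; cases q; cases f) (auto simp: positions_def turn_pos_def split: if_splits)
qed

section \<open>Single edges and their flips; \<open>m\<close> is the middle coordinate\<close>

locale odd_cube =
  fixes n m :: nat
  assumes n_m: "n + 1 = 2 * m" and m2: "2 \<le> m"
begin

lemma n_facts:
  "Suc 0 \<noteq> m" "Suc 0 \<noteq> n" "m \<noteq> n" "m \<noteq> Suc 0" "n \<noteq> Suc 0" "n \<noteq> m"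
  "Suc 0 \<le> m" "Suc 0 \<le> n" "m \<le> n" "Suc n - m = m" "Suc n - n = Suc 0"
  "n div 2 = m - Suc 0" "Suc n div 2 = m"
  using n_m m2 by auto

lemma single_edges_eq:
  "single_edges n =
    {(m, n, n), (m, n, 1), (1, n, m), (n, n, m), (m, 1, n), (m, 1, 1), (1, 1, m), (n, 1, m),
     (n, m, n), (1, m, n), (n, m, 1), (1, m, 1)}"
  by (auto simp: single_edges_def Let_def n_facts)

lemma single_edges_positions: "single_edges n \<subseteq> positions n"
  by (simp add: single_edges_eq positions_def n_facts)

lemma ex1_opp:
  assumes "s \<in> edge_facelets n"
  shows "\<exists>!g. g \<noteq> fst s \<and> (g, snd s) \<in> facelets n"
proof -
  obtain f p where s: "s = (f, p)" by (cases s)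
  have "p \<in> single_edges n" "(f, p) \<in> facelets n"
    using assms by (simp_all add: s edge_facelets_def)
  then show ?thesis
    unfolding Ex1_def face_ex_iff face_all_iff s fst_conv snd_conv single_edges_eq
    by (elim insertE emptyE; hypsubst; cases f) (simp_all add: facelets_iff n_facts)
qed

lemma opp_props:
  assumes "s \<in> edge_facelets n"
  shows "fst (opp n s) \<noteq> fst s" "snd (opp n s) = snd s" "opp n s \<in> edge_facelets n"
  using theI'[OF ex1_opp[OF assms]] assms by (auto simp: opp_def edge_facelets_def)

lemma opp_eqI:
  assumes "s \<in> edge_facelets n" "t \<in> facelets n" "fst t \<noteq> fst s" "snd t = snd s"
  shows "opp n s = t"
proof -
  have "(THE g. g \<noteq> fst s \<and> (g, snd s) \<in> facelets n) = fst t"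
    by (rule the1_equality[OF ex1_opp[OF assms(1)]]) (metis assms(2-4) prod.collapse)
  then show ?thesis
    using assms(4) by (simp add: opp_def prod_eq_iff)
qed

lemma opp_opp: "s \<in> edge_facelets n \<Longrightarrow> opp n (opp n s) = s"
  using opp_props[of s] by (intro opp_eqI) (simp_all add: edge_facelets_def)

lemma edge_faceletsI: "s \<in> facelets n \<Longrightarrow> snd s \<in> P \<Longrightarrow> P \<subseteq> single_edges n \<Longrightarrow> s \<in> edge_facelets n"
  by (auto simp: edge_facelets_def)

lemma snd_flip: "snd (flip n P s) = snd s"
  by (simp add: flip_def opp_def)

lemma flip_facelets:
  "P \<subseteq> single_edges n \<Longrightarrow> s \<in> facelets n \<Longrightarrow> flip n P s \<in> facelets n"
  using opp_props(3)[OF edge_faceletsI[of s P]] by (auto simp: flip_def edge_facelets_def)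

text \<open>Flips act within each cubie separately, and a cubie flipped twice is restored by
  \<open>opp_opp\<close>. Hence flips multiply like sets under symmetric difference.\<close>

lemma flip_flip:
  assumes "P \<subseteq> single_edges n" "Q \<subseteq> single_edges n" "s \<in> facelets n"
  shows "flip n P (flip n Q s) = flip n ((P - Q) \<union> (Q - P)) s"
proof (cases "snd s \<in> Q")
  case True
  with opp_opp[OF edge_faceletsI[OF assms(3) True assms(2)]] show ?thesis
    by (auto simp: flip_def opp_def)
qed (auto simp: flip_def)

lemma bij_flip:
  assumes "P \<subseteq> single_edges n"
  shows "bij_betw (flip n P) (facelets n) (facelets n)"
proof (rule bij_betw_byWitness[where f' = "flip n P"])
  have "flip n P (flip n P s) = s" if "s \<in> facelets n" for s
    using flip_flip[OF assms assms that] by (simp add: flip_def)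
  then show "\<forall>s\<in>facelets n. flip n P (flip n P s) = s" "\<forall>s\<in>facelets n. flip n P (flip n P s) = s"
    by auto
qed (use flip_facelets[OF assms] in auto)

lemma turn_pos_single_edges: "p \<in> single_edges n \<Longrightarrow> turn_pos n f p \<in> single_edges n"
  unfolding single_edges_eq
  by (elim insertE emptyE; hypsubst; cases f) (simp_all add: turn_pos_def n_facts)

lemma turn_edge_facelets: "s \<in> edge_facelets n \<Longrightarrow> turn n f 1 s \<in> edge_facelets n"
  using turn_facelets[of s n f 1] turn_pos_single_edges[of "snd s" f]
  unfolding edge_facelets_def mem_Collect_eq snd_turn by blast

text \<open>A turn carries both stickers of a cubie to the same position and keeps their faces
  distinct, so partners remain partners.\<close>

lemma opp_turn:
  assumes "s \<in> edge_facelets n"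
  shows "opp n (turn n f 1 s) = turn n f 1 (opp n s)"
proof (rule opp_eqI)
  show "turn n f 1 s \<in> edge_facelets n"
    by (rule turn_edge_facelets[OF assms])
  show "turn n f 1 (opp n s) \<in> facelets n"
    using opp_props(3)[OF assms] by (simp add: edge_facelets_def turn_facelets)
  show "fst (turn n f 1 (opp n s)) \<noteq> fst (turn n f 1 s)"
    using opp_props[OF assms] by (simp add: turn_def rot_def rot_face_inject)
  show "snd (turn n f 1 (opp n s)) = snd (turn n f 1 s)"
    unfolding snd_turn opp_props(2)[OF assms] ..
qed

lemma flip_turn:
  assumes "P \<subseteq> single_edges n" "s \<in> facelets n"
  shows "flip n (turn_pos n f ` P) (turn n f 1 s) = turn n f 1 (flip n P s)"
proof -
  have "snd s \<in> positions n"
    using assms(2) by (auto simp: facelets_def)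
  then have "turn_pos n f (snd s) \<in> turn_pos n f ` P \<longleftrightarrow> snd s \<in> P"
    using inj_on_image_mem_iff[OF inj_on_turn_pos] single_edges_positions assms(1)
    by (metis subset_trans)
  then show ?thesis
    using opp_turn[OF edge_faceletsI[OF assms(2) _ assms(1)]]
    by (simp only: flip_def snd_turn split: if_split) auto
qed

lemma reachable_turn1: "reachable n (turn n f 1)"
  by (rule reachable_turn) (use n_m m2 in auto)

text \<open>By \<open>flip_turn\<close>, the new flip is the conjugate of \<open>flip n P\<close> by
  a face turn.\<close>

lemma reachable_flip_turn_pos:
  assumes "P \<subseteq> single_edges n" "reachable n (flip n P)"
  shows "reachable n (flip n (turn_pos n f ` P))"
proof (rule reachable_cancel)
  show "bij_betw (flip n (turn_pos n f ` P)) (facelets n) (facelets n)"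
    by (rule bij_flip) (use assms(1) turn_pos_single_edges in auto)
  show "reachable n (turn n f 1)" by (rule reachable_turn1)
  have "reachable n (turn n f 1 \<circ> flip n P)"
    by (rule reachable_comp[OF reachable_turn1 assms(2)])
  then show "reachable n (flip n (turn_pos n f ` P) \<circ> turn n f 1)"
    using flip_turn[OF assms(1)] reachable_cong[of n "flip n (turn_pos n f ` P) \<circ> turn n f 1" "turn n f 1 \<circ> flip n P"]
    by simp
qed

section \<open>Flipping two adjacent single edges\<close>

lemma reachable_slab: "j \<le> n div 2 \<Longrightarrow> reachable n (slab n j)"
proof (induction j)
  case 0
  have "slab n 0 s = s" if "s \<in> facelets n" for s
    using that by (cases s) (auto simp: slab_def facelets_def positions_def)
  then show ?case
    using reachable_id reachable_cong[of n "slab n 0" "\<lambda>s. s"] by simp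
next
  case (Suc j)
  let ?U = "turn n FaceU (Suc j)" and ?D = "turn n FaceD (Suc j)"
  \<comment> \<open>Clockwise at D is opposite to clockwise at U, so three D turns rotate the lower
    layer in the sense of U.\<close>
  have "reachable n (?U \<circ> (?D \<circ> (?D \<circ> (?D \<circ> slab n j))))"
    using Suc by (intro reachable_comp reachable_turn) auto
  moreover have "slab n (Suc j) s = ?U (?D (?D (?D (slab n j s))))" if "s \<in> facelets n" for s
  proof -
    obtain f x y z where sz: "s = (f, x, y, z)" by (metis prod.exhaust)
    \<comment> \<open>The layers added from below and above are \<open>Suc j\<close> and
      \<open>n - j\<close>; they differ because \<open>j\<close> stays below the middle.\<close>
    have b: "1 \<le> x" "x \<le> n" "1 \<le> y" "y \<le> n" "1 \<le> z" "z \<le> n" "Suc j \<noteq> n - j" "Suc j < n - j"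
      using that Suc.prems n_m by (auto simp: sz facelets_def positions_def)
    show ?thesis
      using b by (cases f) (auto simp: sz slab_def turn_def rot_def Let_def)
  qed
  ultimately show ?case
    using reachable_cong[of n "slab n (Suc j)" "?U \<circ> (?D \<circ> (?D \<circ> (?D \<circ> slab n j)))"] by simp
qed

lemma reflect_iff:
  assumes "1 \<le> x" "x \<le> n"
  shows "Suc n - x = m \<longleftrightarrow> x = m" "Suc n - x = n \<longleftrightarrow> x = 1" "Suc n - x = Suc 0 \<longleftrightarrow> x = n"
    "Suc n - (Suc n - x) = x"
  using assms n_m by auto

definition outer_rot :: "facelet \<Rightarrow> facelet" where
  "outer_rot s = (if fst (snd (snd s)) = m then s else rot n FaceU s)"

lemma reachable_outer_rot: "reachable n outer_rot"
proof -
  have "slab n (m - 1) s = outer_rot s" if "s \<in> facelets n" for s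
    using that n_m m2
    by (cases s) (auto simp: slab_def outer_rot_def Let_def facelets_def positions_def)
  moreover have "reachable n (slab n (m - 1))"
    by (rule reachable_slab) (simp add: n_facts)
  ultimately show ?thesis
    using reachable_cong[of n "slab n (m - 1)" outer_rot] by simp
qed

definition mono_flip :: "facelet \<Rightarrow> facelet" where
  "mono_flip = turn n FaceR 1 \<circ> outer_rot \<circ> outer_rot \<circ> turn n FaceL 1 \<circ> turn n FaceL 1 \<circ>
     outer_rot \<circ> turn n FaceF 1"

lemma reachable_mono_flip: "reachable n mono_flip"
  unfolding mono_flip_def by (intro reachable_comp reachable_turn1 reachable_outer_rot)

lemma opp_UR:
  "opp n (FaceU, n, n, m) = (FaceR, n, n, m)" "opp n (FaceR, n, n, m) = (FaceU, n, n, m)"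
  by (rule opp_eqI; simp add: edge_facelets_def single_edges_eq facelets_iff n_facts)+

lemma mono_flip_top:
  assumes "s \<in> facelets n" "in_slice n FaceU 1 (snd s)"
  shows "mono_flip s = flip n {(n, n, m)} (rot n FaceD s)"
proof -
  obtain f x y z where s: "s = (f, x, y, z)" by (metis prod.exhaust)
  have y: "y = n" and b: "1 \<le> x" "x \<le> n" "1 \<le> z" "z \<le> n"
    using assms by (auto simp: s facelets_def positions_def)
  \<comment> \<open>The path of a facelet through the seven factors of \<open>mono_flip\<close>
    depends only on which of \<open>x\<close> and \<open>z\<close> equal 1, \<open>m\<close> or
    \<open>n\<close>. Naming the reflected coordinates reduces every such test to one on
    \<open>x\<close> or \<open>z\<close>.\<close>
  obtain x' where x': "Suc n - x = x'" "Suc n - x' = x" "x' = m \<longleftrightarrow> x = m"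
     "x' = n \<longleftrightarrow> x = Suc 0" "x' = Suc 0 \<longleftrightarrow> x = n"
    using reflect_iff[OF b(1,2)] by simp
  obtain z' where z': "Suc n - z = z'" "Suc n - z' = z" "z' = m \<longleftrightarrow> z = m"
     "z' = n \<longleftrightarrow> z = Suc 0" "z' = Suc 0 \<longleftrightarrow> z = n"
    using reflect_iff[OF b(3,4)] by simp
  note [simp] = turn_def rot_def outer_rot_def flip_def opp_UR x' z' n_facts
  consider "f = FaceU" | "f = FaceF" "z = n" | "f = FaceB" "z = Suc 0"
    | "f = FaceR" "x = n" | "f = FaceL" "x = Suc 0"
    using assms(1) by (cases f) (simp_all add: s y facelets_iff)
  then show ?thesis
    unfolding mono_flip_def comp_def s y
  proof cases
    case 1
    then show "turn n FaceR 1 (outer_rot (outer_rot (turn n FaceL 1 (turn n FaceL 1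
        (outer_rot (turn n FaceF 1 (f, x, n, z))))))) = flip n {(n, n, m)} (rot n FaceD (f, x, n, z))"
      by (cases "x = Suc 0"; cases "x = m"; cases "x = n";
          cases "z = Suc 0"; cases "z = m"; cases "z = n") simp_all
  qed (cases "x = Suc 0"; cases "x = m"; cases "x = n";
       cases "z = Suc 0"; cases "z = m"; cases "z = n"; simp)+
qed

lemma rot_facelets: "s \<in> facelets n \<Longrightarrow> rot n f s \<in> facelets n"
proof -
  assume s: "s \<in> facelets n"
  obtain g x y z where sz: "s = (g, x, y, z)" by (metis prod.exhaust)
  show ?thesis
    using s unfolding sz rot_def by (cases f; cases g; auto simp: facelets_iff)
qed

lemma rot_U_D:
  assumes "s \<in> facelets n"
  shows "rot n FaceU (rot n FaceD s) = s" "rot n FaceD (rot n FaceU s) = s"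
proof -
  obtain g x y z where s: "s = (g, x, y, z)" by (metis prod.exhaust)
  show "rot n FaceU (rot n FaceD s) = s" "rot n FaceD (rot n FaceU s) = s"
    using assms by (cases g; auto simp: s rot_def facelets_def positions_def)+
qed

text \<open>With \<open>A\<close> for \<open>mono_flip\<close>, the identity
  \<open>flip {UR, UF} U A = A U\<close> exhibits this flip as the commutator
  \<open>A U A^-1 U^-1\<close>. It is checked separately on the top layer \<open>?T\<close> and on
  its complement.\<close>

lemma reachable_flip_UR_UF: "reachable n (flip n {(n, n, m), (m, n, n)})"
proof (rule reachable_cancel)
  let ?a = "(n, n, m)" and ?b = "(m, n, n)" and ?U = "turn n FaceU 1"
  let ?T = "{s \<in> facelets n. in_slice n FaceU 1 (snd s)}"
  have ab: "{?a} \<subseteq> single_edges n" "{?b} \<subseteq> single_edges n" "{?a, ?b} \<subseteq> single_edges n"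
    by (auto simp: single_edges_eq)
  show "bij_betw (flip n {?a, ?b}) (facelets n) (facelets n)"
    by (rule bij_flip[OF ab(3)])
  show "reachable n (?U \<circ> mono_flip)"
    by (intro reachable_comp reachable_turn1 reachable_mono_flip)
  have U: "?U s = rot n FaceU s" if "s \<in> ?T" for s
    using that by (simp add: turn_def)
  have rotD: "rot n FaceD s \<in> ?T" if "s \<in> ?T" for s
    using that rot_facelets[of s FaceD] by (cases s) (auto simp: rot_def)
  have rotU: "rot n FaceU s \<in> ?T" if "s \<in> ?T" for s
    using that rot_facelets[of s FaceU] by (simp add: rot_def in_slice_rot_pos)
  have top: "mono_flip s = flip n {?a} (rot n FaceD s)" if "s \<in> ?T" for s
    using mono_flip_top that by simp
  have A_T: "mono_flip s \<in> ?T" if "s \<in> ?T" for s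
    using rotD[OF that] reachable_maps[OF reachable_mono_flip, of s] that
    unfolding top[OF that] by (simp add: snd_flip)
  \<comment> \<open>An injective self-map of the finite set \<open>?T\<close> is onto. Hence
    \<open>mono_flip\<close> sends no facelet from outside into \<open>?T\<close>; there both
    \<open>?U\<close> and the flip act trivially.\<close>
  have surj: "mono_flip ` ?T = ?T"
  proof (rule endo_inj_surj)
    show "finite ?T" using finite_facelets by simp
    show "inj_on mono_flip ?T"
      by (rule inj_on_subset[OF reachable_inj[OF reachable_mono_flip]]) auto
    show "mono_flip ` ?T \<subseteq> ?T" using A_T by (rule image_subsetI)
  qed
  have A_T': "s \<in> ?T" if s: "s \<in> facelets n" "mono_flip s \<in> ?T" for s
  proof -
    obtain t where t: "t \<in> ?T" "mono_flip s = mono_flip t"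
      using s(2) surj by blast
    have "s = t"
      by (rule inj_onD[OF reachable_inj[OF reachable_mono_flip] t(2) s(1)]) (use t(1) in simp)
    with t(1) show ?thesis by blast
  qed
  \<comment> \<open>Moving the flip past \<open>?U\<close> shifts it from UR to UF, which is why the
    commutator flips two different edges.\<close>
  have tb: "turn_pos n FaceU ` {?a} = {?b}"
    by (simp add: turn_pos_def n_facts)
  have "flip n {?a, ?b} (?U (mono_flip s)) = mono_flip (?U s)" if s: "s \<in> facelets n" for s
  proof (cases "s \<in> ?T")
    case True
    have "?U (mono_flip s) = flip n {?b} (?U (rot n FaceD s))"
      unfolding top[OF True] tb[symmetric]
      by (rule flip_turn[OF ab(1), symmetric]) (use rotD[OF True] in simp)
    also have "\<dots> = flip n {?b} s"
      using U[OF rotD[OF True]] rot_U_D(1)[OF s] by simp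
    finally have "flip n {?a, ?b} (?U (mono_flip s)) = flip n {?a} s"
      using flip_flip[OF ab(3) ab(2) s] n_facts by (simp add: insert_Diff_if)
    also have "\<dots> = mono_flip (?U s)"
      using U[OF True] top[OF rotU[OF True]] rot_U_D(2)[OF s] by simp
    finally show ?thesis .
  next
    case False
    then have "mono_flip s \<notin> ?T" using A_T' s by blast
    then have "\<not> in_slice n FaceU 1 (snd (mono_flip s))"
      using reachable_maps[OF reachable_mono_flip s] by blast
    then show ?thesis
      using False s by (auto simp: turn_def flip_def)
  qed
  moreover have "reachable n (mono_flip \<circ> ?U)"
    by (intro reachable_comp reachable_turn1 reachable_mono_flip)
  ultimately show "reachable n (flip n {?a, ?b} \<circ> (?U \<circ> mono_flip))"
    using reachable_cong[of n "flip n {?a, ?b} \<circ> (?U \<circ> mono_flip)" "mono_flip \<circ> ?U"] by simp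
qed

section \<open>Flipping arbitrary pairs of single edges\<close>

definition linked :: "position \<Rightarrow> position \<Rightarrow> bool" where
  "linked a b \<longleftrightarrow> a \<in> single_edges n \<and> b \<in> single_edges n \<and> reachable n (flip n (sym_diff {a} {b}))"

lemma reachable_flip_sym_diff:
  assumes "P \<subseteq> single_edges n" "Q \<subseteq> single_edges n" "reachable n (flip n P)" "reachable n (flip n Q)"
  shows "reachable n (flip n (sym_diff P Q))"
proof -
  have "reachable n (flip n P \<circ> flip n Q) \<longleftrightarrow> reachable n (flip n (sym_diff P Q))"
    by (rule reachable_cong) (simp add: flip_flip[OF assms(1,2)])
  with reachable_comp[OF assms(3,4)] show ?thesis by blast
qed

lemma linked_sym: "linked a b \<Longrightarrow> linked b a"
  unfolding linked_def by (simp add: Un_commute)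

lemma linked_trans: "linked a b \<Longrightarrow> linked b c \<Longrightarrow> linked a c"
proof -
  assume ab: "linked a b" and bc: "linked b c"
  \<comment> \<open>The two flips of \<open>b\<close> cancel. Writing pairs as
    \<open>sym_diff {a} {b}\<close> keeps this valid when edges coincide, since a repeated edge
    gives the empty flip.\<close>
  have "sym_diff (sym_diff {a} {b}) (sym_diff {b} {c}) = sym_diff {a} {c}" by auto
  then show ?thesis
    using ab bc reachable_flip_sym_diff[of "sym_diff {a} {b}" "sym_diff {b} {c}"]
    by (auto simp: linked_def)
qed

lemma linked_turn_pos: "linked a b \<Longrightarrow> linked (turn_pos n f a) (turn_pos n f b)"
proof -
  assume ab: "linked a b"
  then have e: "a \<in> single_edges n" "b \<in> single_edges n" by (auto simp: linked_def)
  then have p: "a \<in> positions n" "b \<in> positions n" using single_edges_positions by auto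
  have "turn_pos n f ` sym_diff {a} {b} = sym_diff {turn_pos n f a} {turn_pos n f b}"
    using inj_onD[OF inj_on_turn_pos, of n f a b] p by (cases "a = b") auto
  then show ?thesis
    using reachable_flip_turn_pos[of "sym_diff {a} {b}" f] ab e turn_pos_single_edges[of _ f]
    by (auto simp: linked_def)
qed

text \<open>Turns of U carry the pair UR, UF around the top. Turns of F, B and L leave UR in place
  and carry its partner to the other edges, all except DR.\<close>

lemma linked_UR: "a \<in> single_edges n \<Longrightarrow> linked (n, n, m) a"
proof -
  note T = linked_turn_pos[where f = FaceU] linked_turn_pos[where f = FaceF]
    linked_turn_pos[where f = FaceB] linked_turn_pos[where f = FaceL] linked_turn_pos[where f = FaceR]
  note [simp] = turn_pos_def n_facts
  have uf: "linked (n, n, m) (m, n, n)"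
    using reachable_flip_UR_UF by (auto simp: linked_def single_edges_eq insert_commute insert_Diff_if)
  have ul: "linked (n, n, m) (1, n, m)"
    using linked_trans[OF uf] T(1)[OF uf] by simp
  have ub: "linked (n, n, m) (m, n, 1)"
    using linked_trans[OF ul] T(1)[OF T(1)[OF uf]] by simp
  have uu: "linked (n, n, m) (n, n, m)"
    using linked_trans[OF uf linked_sym[OF uf]] .
  have fr: "linked (n, n, m) (n, m, n)" using T(2)[OF uf] by simp
  have df: "linked (n, n, m) (m, 1, n)" using T(2)[OF fr] by simp
  have fl: "linked (n, n, m) (1, m, n)" using T(2)[OF df] by simp
  have bl: "linked (n, n, m) (1, m, 1)" using T(3)[OF ub] by simp
  have db: "linked (n, n, m) (m, 1, 1)" using T(3)[OF bl] by simp
  have br: "linked (n, n, m) (n, m, 1)" using T(3)[OF db] by simp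
  have dl: "linked (n, n, m) (1, 1, m)" using T(4)[OF T(4)[OF ul]] by simp
  \<comment> \<open>A half turn of R fixes UF and takes UR to DR, so DR is reached through its link
    with UF.\<close>
  have dr: "linked (n, n, m) (n, 1, m)"
    using linked_trans[OF uf] T(5)[OF T(5)[OF linked_sym[OF uf]]] by simp
  show "a \<in> single_edges n \<Longrightarrow> linked (n, n, m) a"
    unfolding single_edges_eq by (elim insertE emptyE; hypsubst) (rule uf ul ub uu fr df fl bl db br dl dr)+
qed

text \<open>Inserting an edge \<open>a\<close> multiplies by the reachable flip of \<open>a\<close>
  and UR, which exchanges the two alternatives.\<close>

lemma reachable_flip_up_to_UR:
  assumes "P \<subseteq> single_edges n"
  shows "reachable n (flip n P) \<or> reachable n (flip n (sym_diff P {(n, n, m)}))"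
proof -
  have "finite P"
    by (rule finite_subset[OF assms]) (simp add: single_edges_eq)
  then show ?thesis
    using assms
  proof (induction P rule: finite_induct)
    case empty
    have "flip n {} = (\<lambda>s. s)" by (auto simp: flip_def)
    then show ?case using reachable_id by simp
  next
    case (insert a P)
    let ?u = "(n, n, m)"
    have u: "?u \<in> single_edges n" by (simp add: single_edges_eq)
    have au: "reachable n (flip n (sym_diff {?u} {a}))" and a: "a \<in> single_edges n"
      using linked_UR[of a] insert.prems by (auto simp: linked_def)
    have 1: "sym_diff P (sym_diff {?u} {a}) = sym_diff (insert a P) {?u}"
      and 2: "sym_diff (sym_diff P {?u}) (sym_diff {?u} {a}) = insert a P"
      using insert.hyps(2) by auto
    have P: "P \<subseteq> single_edges n" and sub: "sym_diff P {?u} \<subseteq> single_edges n"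
      "sym_diff {?u} {a} \<subseteq> single_edges n"
      using insert.prems u by auto
    show ?case
      using insert.IH[OF P] reachable_flip_sym_diff[OF P sub(2) _ au]
        reachable_flip_sym_diff[OF sub _ au] unfolding 1 2 by blast
  qed
qed

section \<open>Parity on the single edge facelets\<close>

lemma finite_edge_facelets: "finite (edge_facelets n)"
  using finite_facelets by (simp add: edge_facelets_def)

lemma bij_opp: "bij_betw (opp n) (edge_facelets n) (edge_facelets n)"
  by (rule bij_betw_byWitness[where f' = "opp n"]) (use opp_opp opp_props in auto)

lemma in_slice_face: "(f, p) \<in> facelets n \<Longrightarrow> in_slice n f 1 p"
  by (simp add: facelets_def)

text \<open>
  A face turn acts on the single edge facelets as \<open>c \<circ> (opp \<circ> c \<circ> opp)\<close>, where \<open>c\<close> is its restriction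
  to the turned face, so its sign is a square.
\<close>

lemma sign_turn: "sign_on (edge_facelets n) (turn n f 1) = 1"
proof -
  let ?E = "edge_facelets n"
  define c where "c s = (if fst s = f then turn n f 1 s else s)" for s
  have c_E: "c s \<in> ?E" if "s \<in> ?E" for s
    using turn_edge_facelets[OF that] that by (simp add: c_def)
  have fst_turn: "fst (turn n f 1 s) = f \<longleftrightarrow> fst s = f" for s
    by (simp add: turn_def rot_def rot_face_self_iff)
  have inj_turn: "inj_on (turn n f 1) ?E"
    by (rule inj_on_subset[OF reachable_inj[OF reachable_turn1]]) (auto simp: edge_facelets_def)
  have "inj_on c ?E"
  proof (rule inj_onI)
    fix s t assume st: "s \<in> ?E" "t \<in> ?E" "c s = c t"
    have "fst s = f \<longleftrightarrow> fst t = f"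
      using st(3) fst_turn unfolding c_def by metis
    then show "s = t"
      using st inj_onD[OF inj_turn, of s t] by (auto simp: c_def split: if_splits)
  qed
  moreover have "c ` ?E \<subseteq> ?E" using c_E by blast
  ultimately have bij_c: "bij_betw c ?E ?E"
    using endo_inj_surj[OF finite_edge_facelets] by (simp add: bij_betw_def)
  have "turn n f 1 s = (c \<circ> (opp n \<circ> (c \<circ> opp n))) s" if s: "s \<in> ?E" for s
  proof (cases "fst s = f")
    case True
    then show ?thesis
      using opp_props[OF s] opp_opp[OF s] by (simp add: c_def)
  next
    case False
    show ?thesis
    \<comment> \<open>Off face \<open>f\<close>, a facelet in the turned slice has its partner on
      \<open>f\<close> and is moved by the conjugated copy of \<open>c\<close>; any other has no
      partner on \<open>f\<close> and stays.\<close>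
    proof (cases "in_slice n f 1 (snd s)")
      case True
      then have "(f, snd s) \<in> facelets n"
        using s by (cases s) (simp add: edge_facelets_def facelets_def)
      then have "opp n s = (f, snd s)"
        using False by (intro opp_eqI[OF s]) auto
      then have "c (opp n s) = opp n (turn n f 1 s)"
        using opp_turn[OF s, of f] by (simp add: c_def)
      then have "opp n (c (opp n s)) = turn n f 1 s"
        using opp_opp[OF turn_edge_facelets[OF s, of f]] by simp
      moreover have "fst (turn n f 1 s) \<noteq> f"
        using False fst_turn by simp
      ultimately show ?thesis
        by (simp add: c_def)
    next
      case out: False
      have "fst (opp n s) \<noteq> f"
      proof
        assume "fst (opp n s) = f"
        then have "(f, snd s) \<in> facelets n"
          using opp_props[OF s] by (metis (lifting) edge_facelets_def mem_Collect_eq prod.collapse)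
        then show False using in_slice_face out by blast
      qed
      then show ?thesis
        using False opp_opp[OF s] out by (simp add: c_def turn_def)
    qed
  qed
  then have "sign_on ?E (turn n f 1) = sign_on ?E (c \<circ> (opp n \<circ> (c \<circ> opp n)))"
    by (intro sign_on_cong) auto
  also have "\<dots> = sign_on ?E c * (sign_on ?E (opp n) * (sign_on ?E c * sign_on ?E (opp n)))"
    by (simp only: sign_on_compose bij_c bij_opp finite_edge_facelets bij_betw_trans[OF bij_opp bij_c]
      bij_betw_trans[OF bij_betw_trans[OF bij_opp bij_c] bij_opp])
  also have "\<dots> = (sign_on ?E c * sign_on ?E c) * (sign_on ?E (opp n) * sign_on ?E (opp n))"
    by (simp only: mult_ac)
  also have "\<dots> = 1"
    by (simp add: sign_on_def)
  finally show ?thesis .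
qed

text \<open>Single edges have coordinates 1, \<open>m\<close> and \<open>n\<close> only, and neither
  \<open>k\<close> nor \<open>n + 1 - k\<close> takes one of these values.\<close>

lemma turn_inner_edge_facelets:
  assumes "2 \<le> k" "k \<le> n div 2" "s \<in> edge_facelets n"
  shows "turn n f k s = s"
proof -
  have "k \<noteq> m" "k \<noteq> n" "k \<noteq> Suc 0" "Suc n - k \<noteq> m" "Suc n - k \<noteq> n" "Suc n - k \<noteq> Suc 0"
    using assms n_m m2 by auto
  then have "\<not> in_slice n f k (snd s)" if "snd s \<in> single_edges n"
    using that unfolding single_edges_eq
    by (elim insertE emptyE; cases f) (simp_all add: eq_commute[of _ k] eq_commute[of _ "Suc n - k"])
  then show ?thesis
    using assms(3) by (simp add: turn_def edge_facelets_def)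
qed

text \<open>Preservation of \<open>edge_facelets n\<close> is part of the definition because
  multiplicativity of \<open>sign_on\<close> is applied to bijections of that set.\<close>

definition even_on_edges :: "(facelet \<Rightarrow> facelet) set" where
  "even_on_edges = {g \<in> Bij (facelets n). bij_betw g (edge_facelets n) (edge_facelets n) \<and>
     sign_on (edge_facelets n) g = 1}"

lemma subgroup_even_on_edges: "subgroup even_on_edges (BijGroup (facelets n))"
proof
  let ?S = "facelets n" and ?E = "edge_facelets n"
  have E_S: "?E \<subseteq> ?S" by (auto simp: edge_facelets_def)
  show "even_on_edges \<subseteq> carrier (BijGroup ?S)"
    by (auto simp: even_on_edges_def BijGroup_def)
  have id: "(\<lambda>s\<in>?S. s) s = id s" if "s \<in> ?E" for s
    using that E_S by auto
  have "bij_betw (\<lambda>s\<in>?S. s) ?E ?E"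
    using bij_betw_cong[of ?E "\<lambda>s\<in>?S. s" id ?E] id by simp
  moreover have "sign_on ?E (\<lambda>s\<in>?S. s) = 1"
    using sign_on_cong[of ?E ?E "\<lambda>s\<in>?S. s" id, OF refl id] by simp
  ultimately show "\<one>\<^bsub>BijGroup ?S\<^esub> \<in> even_on_edges"
    by (simp add: even_on_edges_def BijGroup_def id_Bij)
  fix g assume g: "g \<in> even_on_edges"
  then have gB: "g \<in> Bij ?S" and g_bij: "bij_betw g ?E ?E" and g_sign: "sign_on ?E g = 1"
    by (auto simp: even_on_edges_def)
  { fix h assume h: "h \<in> even_on_edges"
    then have hB: "h \<in> Bij ?S" and h_bij: "bij_betw h ?E ?E" and h_sign: "sign_on ?E h = 1"
      by (auto simp: even_on_edges_def)
    have eq: "compose ?S g h s = (g \<circ> h) s" if "s \<in> ?E" for s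
      using that E_S by (auto simp: compose_def)
    have "bij_betw (compose ?S g h) ?E ?E"
      using bij_betw_trans[OF h_bij g_bij] bij_betw_cong[of ?E "compose ?S g h" "g \<circ> h" ?E] eq by simp
    moreover have "sign_on ?E (compose ?S g h) = 1"
      using sign_on_cong[of ?E ?E "compose ?S g h" "g \<circ> h"] eq
        sign_on_compose[OF g_bij h_bij finite_edge_facelets] g_sign h_sign by simp
    ultimately show "g \<otimes>\<^bsub>BijGroup ?S\<^esub> h \<in> even_on_edges"
      using gB hB by (simp add: even_on_edges_def BijGroup_def compose_Bij) }
  let ?i = "\<lambda>s\<in>?S. inv_into ?S g s"
  have gi: "?i (g s) = s" if "s \<in> ?E" for s
  proof -
    have "s \<in> ?S" "g s \<in> ?S"
      using that E_S Bij_imp_funcset[OF gB] by auto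
    then show ?thesis
      using gB by (simp add: Bij_def bij_betw_def)
  qed
  have ig: "?i s \<in> ?E \<and> g (?i s) = s" if s: "s \<in> ?E" for s
  proof -
    obtain t where t: "t \<in> ?E" "s = g t"
      using s bij_betw_imp_surj_on[OF g_bij] by blast
    show ?thesis
      unfolding t(2) gi[OF t(1)] using t(1) by simp
  qed
  have i_bij: "bij_betw ?i ?E ?E"
  proof (rule bij_betw_byWitness[where f' = g])
    show "\<forall>s\<in>?E. g (?i s) = s" "?i ` ?E \<subseteq> ?E"
      using ig by blast+
    show "\<forall>s\<in>?E. ?i (g s) = s" using gi by blast
    show "g ` ?E \<subseteq> ?E" using g_bij by (simp add: bij_betw_def)
  qed
  \<comment> \<open>On \<open>?E\<close> the composition with \<open>g\<close> is the identity, so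
    the sign of the inverse follows from that of \<open>g\<close>.\<close>
  have "sign_on ?E ?i * sign_on ?E g = sign_on ?E (?i \<circ> g)"
    by (rule sign_on_compose[OF i_bij g_bij finite_edge_facelets, symmetric])
  also have "\<dots> = sign_on ?E (\<lambda>s. s)"
    by (rule sign_on_cong) (use gi in simp_all)
  finally have "sign_on ?E ?i = 1"
    using g_sign by simp
  then show "inv\<^bsub>BijGroup ?S\<^esub> g \<in> even_on_edges"
    using i_bij by (simp add: inv_BijGroup[OF gB] even_on_edges_def restrict_inv_into_Bij[OF gB])
qed

lemma moves_even_on_edges: "moves n \<subseteq> even_on_edges"
proof
  let ?S = "facelets n" and ?E = "edge_facelets n"
  fix g assume "g \<in> moves n"
  then obtain f k where g: "g = move n f k" and k: "1 \<le> k" "k \<le> n div 2"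
    by (auto simp: moves_def)
  have eq: "g s = turn n f k s" if "s \<in> ?E" for s
    using that unfolding g restrict_turn[symmetric] by (simp add: edge_facelets_def)
  have "bij_betw (turn n f k) ?E ?E \<and> sign_on ?E (turn n f k) = 1"
  proof (cases "k = 1")
    case True
    have "inj_on (turn n f 1) ?E"
      by (rule inj_on_subset[OF reachable_inj[OF reachable_turn1]]) (auto simp: edge_facelets_def)
    moreover have "turn n f 1 ` ?E \<subseteq> ?E"
      using turn_edge_facelets by blast
    ultimately show ?thesis
      using True sign_turn endo_inj_surj[OF finite_edge_facelets] by (simp add: bij_betw_def)
  next
    case False
    then have "turn n f k s = id s" if "s \<in> ?E" for s
      using k turn_inner_edge_facelets[OF _ k(2) that] by simp
    then show ?thesis
      using bij_betw_cong[of ?E "turn n f k" id ?E] sign_on_cong[of ?E ?E "turn n f k" id]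
      by simp
  qed
  then have "bij_betw g ?E ?E" "sign_on ?E g = 1"
    using bij_betw_cong[of ?E g "turn n f k" ?E] sign_on_cong[of ?E ?E g "turn n f k"] eq by simp_all
  then show "g \<in> even_on_edges"
    by (simp add: even_on_edges_def g move_in_Bij)
qed

lemma sign_cube_group: "g \<in> carrier (cube_group n) \<Longrightarrow> sign_on (edge_facelets n) g = 1"
  using group.generate_subgroup_incl[OF group_BijGroup moves_even_on_edges subgroup_even_on_edges]
  unfolding carrier_cube_group by (auto simp: even_on_edges_def)

lemma ex_facelet: "p \<in> single_edges n \<Longrightarrow> \<exists>f. (f, p) \<in> facelets n"
  unfolding face_ex_iff single_edges_eq
  by (elim insertE emptyE; hypsubst) (simp_all add: facelets_iff n_facts)

text \<open>On the edge facelets this flip is the transposition of the two stickers at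
  \<open>p\<close>, which has sign -1, whereas \<open>sign_cube_group\<close> forces sign 1.\<close>

lemma not_reachable_flip_single:
  assumes "p \<in> single_edges n"
  shows "\<not> reachable n (flip n {p})"
proof
  let ?E = "edge_facelets n"
  assume r: "reachable n (flip n {p})"
  obtain f where f: "(f, p) \<in> facelets n"
    using ex_facelet[OF assms] by blast
  let ?s = "(f, p)"
  have s: "?s \<in> ?E" using f assms by (simp add: edge_facelets_def)
  have "restrict (flip n {p}) (facelets n) t = Transposition.transpose ?s (opp n ?s) t" if t: "t \<in> ?E" for t
  proof (cases "snd t = p")
    case True
    show ?thesis
    proof (cases "t = ?s")
      case False
      then have "t = opp n ?s"
        using opp_eqI[OF s, of t] t True by (auto simp: edge_facelets_def prod_eq_iff)
      then show ?thesis
        using t opp_opp[OF s] True by (simp add: flip_def edge_facelets_def)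
    qed (use f in \<open>simp add: flip_def\<close>)
  next
    case False
    then have "t \<noteq> ?s" "t \<noteq> opp n ?s" using opp_props(2)[OF s] by auto
    then show ?thesis
      using False t by (simp add: flip_def edge_facelets_def)
  qed
  then have "sign_on ?E (restrict (flip n {p}) (facelets n)) = sign_on ?E (Transposition.transpose ?s (opp n ?s))"
    by (intro sign_on_cong) auto
  also have "\<dots> = -1"
    by (rule sign_on_transpose) (use opp_props[OF s] s in auto)
  finally show False
    using sign_cube_group[OF r[unfolded reachable_def]] by presburger
qed

section \<open>The orientation subgroup as the reachable flips\<close>

lemma single_edge_orientations_eq:
  "single_edge_orientations n =
    {restrict (flip n P) (facelets n) | P. P \<subseteq> single_edges n \<and> reachable n (flip n P)}"
proof (intro equalityI subsetI)
  let ?S = "facelets n"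
  fix g assume "g \<in> single_edge_orientations n"
  then have gC: "g \<in> carrier (cube_group n)"
    and pos: "\<And>s. s \<in> ?S \<Longrightarrow> snd (g s) = snd s"
    and fixed: "\<And>s. s \<in> ?S \<Longrightarrow> snd s \<notin> single_edges n \<Longrightarrow> g s = s"
    by (auto simp: single_edge_orientations_def)
  have ext: "restrict g ?S = g"
    using Bij_imp_extensional[OF cube_group_Bij[OF gC]] by (rule extensional_restrict)
  have r: "reachable n g"
    using gC by (simp add: reachable_def ext)
  \<comment> \<open>A cubie belongs to \<open>P\<close> as soon as one of its stickers moves; the
    other must then move as well.\<close>
  define P where "P = {p \<in> single_edges n. \<exists>s\<in>?S. snd s = p \<and> g s \<noteq> s}"
  have moved: "g s = opp n s" if "s \<in> ?S" "g s \<noteq> s" for s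
  proof -
    have s: "s \<in> edge_facelets n"
      using fixed[OF that(1)] that by (auto simp: edge_facelets_def)
    show ?thesis
      using opp_eqI[OF s reachable_maps[OF r that(1)]] pos[OF that(1)] that(2)
      by (auto simp: prod_eq_iff)
  qed
  have "g s = flip n P s" if s: "s \<in> ?S" for s
  proof (cases "snd s \<in> P")
    case True
    then have e: "s \<in> edge_facelets n" using s by (auto simp: P_def edge_facelets_def)
    obtain t where t: "t \<in> ?S" "snd t = snd s" "g t \<noteq> t"
      using True by (auto simp: P_def)
    have "g s \<noteq> s"
    proof
      \<comment> \<open>The moved sticker \<open>t\<close> would be the partner of \<open>s\<close>
        and hence go to \<open>s\<close>, which \<open>s\<close> itself already occupies, against
        injectivity.\<close>
      assume gs: "g s = s"
      with t have "t \<noteq> s" by auto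
      then have "fst t \<noteq> fst s" using t(2) by (auto simp: prod_eq_iff)
      then have ts: "opp n s = t"
        by (rule opp_eqI[OF e t(1) _ t(2)])
      then have "g t = s"
        using moved[OF t(1,3)] opp_opp[OF e] by simp
      then have "g t = g s" using gs by simp
      then have "t = s" by (rule inj_onD[OF reachable_inj[OF r] _ t(1) s])
      with \<open>t \<noteq> s\<close> show False ..
    qed
    then show ?thesis
      using moved[OF s] True by (simp add: flip_def)
  next
    case False
    then have "g s = s"
      using s fixed[OF s] by (auto simp: P_def)
    then show ?thesis using False by (simp add: flip_def)
  qed
  then have "g = restrict (flip n P) ?S"
    using ext by (metis restrict_ext)
  moreover have "P \<subseteq> single_edges n" by (auto simp: P_def)
  ultimately show "g \<in> {restrict (flip n P) ?S | P. P \<subseteq> single_edges n \<and> reachable n (flip n P)}"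
    using gC by (auto simp: reachable_def)
next
  fix g assume "g \<in> {restrict (flip n P) (facelets n) | P. P \<subseteq> single_edges n \<and> reachable n (flip n P)}"
  then show "g \<in> single_edge_orientations n"
    by (auto simp: single_edge_orientations_def reachable_def snd_flip) (auto simp: flip_def)
qed

lemma mult_flip:
  assumes "P \<subseteq> single_edges n" "Q \<subseteq> single_edges n" "reachable n (flip n P)" "reachable n (flip n Q)"
  shows "restrict (flip n P) (facelets n) \<otimes>\<^bsub>cube_group n\<^esub> restrict (flip n Q) (facelets n) =
    restrict (flip n (sym_diff P Q)) (facelets n)"
proof -
  have "restrict (flip n P) (facelets n) \<otimes>\<^bsub>cube_group n\<^esub> restrict (flip n Q) (facelets n) =
      restrict (flip n P \<circ> flip n Q) (facelets n)"
    using assms(3,4) flip_facelets[OF assms(2)]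
    by (simp add: mult_cube_group reachable_def restrict_comp)
  also have "\<dots> = restrict (flip n (sym_diff P Q)) (facelets n)"
    by (rule restrict_ext) (simp add: flip_flip[OF assms(1,2)])
  finally show ?thesis .
qed

lemma restrict_flip_empty: "restrict (flip n {}) (facelets n) = \<one>\<^bsub>cube_group n\<^esub>"
  unfolding one_cube_group by (rule restrict_ext) (simp add: flip_def)

lemma subgroup_single_edge_orientations:
  "subgroup (single_edge_orientations n) (cube_group n)"
proof (rule group.subgroupI[OF group_cube_group])
  show "single_edge_orientations n \<subseteq> carrier (cube_group n)"
    by (auto simp: single_edge_orientations_def)
  have "reachable n (flip n {})"
    using reachable_id reachable_cong[of n "flip n {}" "\<lambda>s. s"] by (simp add: flip_def)
  then show "single_edge_orientations n \<noteq> {}"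
    unfolding single_edge_orientations_eq by blast
next
  fix g assume g: "g \<in> single_edge_orientations n"
  then obtain P where P: "g = restrict (flip n P) (facelets n)" "P \<subseteq> single_edges n" "reachable n (flip n P)"
    unfolding single_edge_orientations_eq by blast
  \<comment> \<open>The symmetric difference of \<open>P\<close> with itself is empty, so every
    element is its own inverse.\<close>
  have "g \<otimes>\<^bsub>cube_group n\<^esub> g = \<one>\<^bsub>cube_group n\<^esub>"
    using mult_flip[OF P(2,2,3,3)] restrict_flip_empty unfolding P(1) by simp
  then have "inv\<^bsub>cube_group n\<^esub> g = g"
    using P by (intro group.inv_equality[OF group_cube_group]) (simp_all add: reachable_def)
  then show "inv\<^bsub>cube_group n\<^esub> g \<in> single_edge_orientations n"
    using g by simp
next
  fix g h assume "g \<in> single_edge_orientations n" "h \<in> single_edge_orientations n"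
  then obtain P Q where P: "g = restrict (flip n P) (facelets n)" "P \<subseteq> single_edges n" "reachable n (flip n P)"
    and Q: "h = restrict (flip n Q) (facelets n)" "Q \<subseteq> single_edges n" "reachable n (flip n Q)"
    unfolding single_edge_orientations_eq by blast
  have "g \<otimes>\<^bsub>cube_group n\<^esub> h = restrict (flip n (sym_diff P Q)) (facelets n)"
    unfolding P(1) Q(1) by (rule mult_flip[OF P(2) Q(2) P(3) Q(3)])
  moreover have "sym_diff P Q \<subseteq> single_edges n" using P(2) Q(2) by auto
  ultimately show "g \<otimes>\<^bsub>cube_group n\<^esub> h \<in> single_edge_orientations n"
    unfolding single_edge_orientations_eq
    using reachable_flip_sym_diff[OF P(2) Q(2) P(3) Q(3)] by blast
qed

section \<open>The isomorphism with eleven copies of the integers mod 2\<close>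

definition flipped :: "(facelet \<Rightarrow> facelet) \<Rightarrow> position set" where
  "flipped g = {p. \<exists>s\<in>facelets n. snd s = p \<and> g s \<noteq> s}"

text \<open>Each position in \<open>P\<close> carries a facelet, and \<open>opp\<close> moves it. So
  the set \<open>P\<close> can be recovered from the permutation alone.\<close>

lemma flipped_flip:
  assumes "P \<subseteq> single_edges n"
  shows "flipped (restrict (flip n P) (facelets n)) = P"
proof (intro equalityI subsetI)
  fix p assume p: "p \<in> P"
  then obtain f where f: "(f, p) \<in> facelets n" using ex_facelet assms by blast
  have "(f, p) \<in> edge_facelets n" using f p assms by (auto simp: edge_facelets_def)
  then have "flip n P (f, p) \<noteq> (f, p)"
    using opp_props(1)[of "(f, p)"] p by (auto simp: flip_def)
  then show "p \<in> flipped (restrict (flip n P) (facelets n))"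
    using f by (auto simp: flipped_def intro!: bexI[of _ "(f, p)"])
qed (auto simp: flipped_def flip_def split: if_splits)

text \<open>The map records the flips at all edges but UR. Parity makes the omitted value determined
  by the others, giving injectivity; freedom in choosing it gives surjectivity.\<close>

lemma iso_product_group:
  assumes e: "bij_betw e I (single_edges n - {(n, n, m)})"
  defines "\<phi> \<equiv> \<lambda>g. \<lambda>i\<in>I. if e i \<in> flipped g then 1 else (0::int)"
  shows "\<phi> \<in> iso ((cube_group n)\<lparr>carrier := single_edge_orientations n\<rparr>)
    (product_group I (\<lambda>_. integer_mod_group 2))"
proof -
  let ?u = "(n, n, m)" and ?S = "facelets n" and ?O = "single_edge_orientations n"
  let ?C = "\<Pi>\<^sub>E i\<in>I. carrier (integer_mod_group 2)"
  have u: "?u \<in> single_edges n" by (simp add: single_edges_eq)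
  have \<phi>_flip: "\<phi> (restrict (flip n P) ?S) = (\<lambda>i\<in>I. if e i \<in> P then 1 else 0)"
    if "P \<subseteq> single_edges n" for P
    using flipped_flip[OF that] by (simp add: \<phi>_def)
  have hom: "\<phi> (g \<otimes>\<^bsub>cube_group n\<^esub> h) = (\<lambda>i\<in>I. (\<phi> g i + \<phi> h i) mod 2)"
    if gh: "g \<in> ?O" "h \<in> ?O" for g h
  proof -
    obtain P Q where P: "g = restrict (flip n P) ?S" "P \<subseteq> single_edges n" "reachable n (flip n P)"
      and Q: "h = restrict (flip n Q) ?S" "Q \<subseteq> single_edges n" "reachable n (flip n Q)"
      using gh unfolding single_edge_orientations_eq by blast
    have sub: "sym_diff P Q \<subseteq> single_edges n" using P(2) Q(2) by auto
    \<comment> \<open>The indicator of a symmetric difference is the sum of the indicators mod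
      2.\<close>
    show ?thesis
      unfolding P(1) Q(1) mult_flip[OF P(2) Q(2) P(3) Q(3)] \<phi>_flip[OF P(2)] \<phi>_flip[OF Q(2)] \<phi>_flip[OF sub]
      by (rule restrict_ext) auto
  qed
  have inj: "inj_on \<phi> ?O"
  proof (rule inj_onI)
    fix g h assume gh: "g \<in> ?O" "h \<in> ?O" "\<phi> g = \<phi> h"
    obtain P Q where P: "g = restrict (flip n P) ?S" "P \<subseteq> single_edges n" "reachable n (flip n P)"
      and Q: "h = restrict (flip n Q) ?S" "Q \<subseteq> single_edges n" "reachable n (flip n Q)"
      using gh(1,2) unfolding single_edge_orientations_eq by blast
    have ePQ: "e i \<in> P \<longleftrightarrow> e i \<in> Q" if "i \<in> I" for i
      using fun_cong[OF gh(3), of i] that unfolding P(1) Q(1) \<phi>_flip[OF P(2)] \<phi>_flip[OF Q(2)]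
      by (simp split: if_splits)
    have "p \<in> P \<longleftrightarrow> p \<in> Q" if "p \<in> single_edges n - {?u}" for p
    proof -
      have "p \<in> e ` I"
        using that bij_betw_imp_surj_on[OF e] by simp
      then obtain i where "p = e i" "i \<in> I" by (rule imageE)
      then show ?thesis using ePQ by simp
    qed
    \<comment> \<open>Equal images leave only UR as a possible difference; a reachable flip of UR
      alone is excluded by parity.\<close>
    then have "sym_diff P Q \<subseteq> {?u}" using P(2) Q(2) by blast
    moreover have "sym_diff P Q \<noteq> {?u}"
      using not_reachable_flip_single[OF u] reachable_flip_sym_diff[OF P(2) Q(2) P(3) Q(3)] by auto
    ultimately have "sym_diff P Q = {}" by (simp add: subset_singleton_iff)
    then have "P = Q" by blast
    then show "g = h" by (simp add: P(1) Q(1))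
  qed
  have surj: "c \<in> \<phi> ` ?O" if c: "c \<in> ?C" for c
  proof -
    define P where "P = e ` {i \<in> I. c i = 1}"
    have P_sub: "P \<subseteq> single_edges n - {?u}"
      using bij_betwE[OF e] by (auto simp: P_def)
    have eP: "e i \<in> P \<longleftrightarrow> c i = 1" if "i \<in> I" for i
      using inj_onD[OF bij_betw_imp_inj_on[OF e], of i] that by (auto simp: P_def)
    have "sym_diff P {?u} \<subseteq> single_edges n" "P - {?u} = P" "sym_diff P {?u} - {?u} = P"
      using P_sub u by auto
    \<comment> \<open>\<open>Q\<close> is \<open>P\<close> with UR toggled if necessary; neither
      choice changes the recorded coordinates.\<close>
    then obtain Q where Q: "Q \<subseteq> single_edges n" "reachable n (flip n Q)" "Q - {?u} = P"
      using reachable_flip_up_to_UR[of P] P_sub by blast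
    have "c i = (if e i \<in> Q then 1 else 0)" if i: "i \<in> I" for i
    proof -
      have "e i \<noteq> ?u" using bij_betwE[OF e] i by blast
      then have "e i \<in> Q \<longleftrightarrow> c i = 1" using eP[OF i] Q(3) by auto
      moreover have "c i \<in> {0..<2}"
        using c i by (auto simp: carrier_integer_mod_group dest!: PiE_mem)
      ultimately show ?thesis by auto
    qed
    moreover have "c \<in> extensional I" using c by (auto simp: PiE_def)
    ultimately have "c = \<phi> (restrict (flip n Q) ?S)"
      unfolding \<phi>_flip[OF Q(1)] by (intro extensionalityI[of c "I"]) auto
    then show ?thesis
      using Q(1,2) unfolding single_edge_orientations_eq by blast
  qed
  have into: "\<phi> g \<in> ?C" for g
    by (auto simp: \<phi>_def carrier_integer_mod_group)
  then have "\<phi> \<in> ?O \<rightarrow> ?C" "\<phi> ` ?O = ?C"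
    using surj by blast+
  then show ?thesis
    using hom inj by (simp add: iso_def hom_def bij_betw_def)
qed

lemma ex_indexing: "\<exists>e. bij_betw e {1..11::nat} (single_edges n - {(n, n, m)})"
proof -
  have "finite (single_edges n)" "card (single_edges n) = 12" "(n, n, m) \<in> single_edges n"
    by (simp_all add: single_edges_eq n_facts)
  then show ?thesis
    using ex_bij_betw_nat_finite_1[of "single_edges n - {(n, n, m)}"] by simp
qed

end

theorem theorem16:
  fixes n :: nat
  assumes "n \<ge> 3" and "odd n"
  shows "subgroup (single_edge_orientations n) (cube_group n) \<and>
    (cube_group n)\<lparr>carrier := single_edge_orientations n\<rparr>
      \<cong> product_group {1..11::nat} (\<lambda>_. integer_mod_group 2)"
proof -
  obtain k where "n = 2 * k + 1"
    using \<open>odd n\<close> by (rule oddE)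
  \<comment> \<open>The middle coordinate is \<open>k + 1\<close>, and \<open>n \<ge> 3\<close>
    makes it at least 2.\<close>
  then interpret odd_cube n "k + 1"
    using \<open>n \<ge> 3\<close> by unfold_locales simp_all
  show ?thesis
    using subgroup_single_edge_orientations ex_indexing iso_product_group unfolding is_iso_def by blast
qed

end
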